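(* There exist triangulations of the $2$-dimensional torus that have a linear realization in the $1\times 2\times 2$-cuboid.
   Context: A triangulated torus is a finite simplicial complex whose underlying space is homeomorphic to the $2$-dimensional torus. For positive integers $a,b,c$, the $a\times b\times c$-cuboid is the box $[0,a]\times[0,b]\times[0,c]\subset\mathbb{R}^3$. A realization in the cuboid places all vertices at integer points of it, i.e. in $\{0,\dots,a\}\times\{0,\dots,b\}\times\{0,\dots,c\}$. A linear realization (linear embedding) of a triangulated surface in $\mathbb{R}^3$ is an assignment of a point of $\mathbb{R}^3$ to each vertex such that, with straight edges and flat triangles, there are no self-intersections (the convex hulls of the vertex images of the simplices are nondegenerate simplices, and any two of them intersect exactly in the convex hull of the image of their common face). Neighboring triangles are allowed to be coplanar. *)

theory Defs
  imports "HOL-Analysis.Analysis"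
begin

definition abstract_simplicial_complex :: "'v set set \<Rightarrow> bool" where
  "abstract_simplicial_complex K \<longleftrightarrow>
     (\<forall>s\<in>K. finite s \<and> s \<noteq> {}) \<and>
     (\<forall>s\<in>K. \<forall>t. t \<subseteq> s \<and> t \<noteq> {} \<longrightarrow> t \<in> K)"

text \<open>
  The underlying space, in barycentric coordinates. It is topologised as a subset of the
  function space with the product topology; for a finite complex this is the usual topology
  of the geometric realization.
\<close>

definition underlying_space :: "'v set set \<Rightarrow> ('v \<Rightarrow> real) set" where
  "underlying_space K =
     {x. (\<forall>v. 0 \<le> x v) \<and> {v. x v \<noteq> 0} \<in> K \<and> (\<Sum>v | x v \<noteq> 0. x v) = 1}"

definition torus :: "(complex \<times> complex) set" where
  "torus = sphere 0 1 \<times> sphere 0 1"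

definition triangulated_torus :: "'v set set \<Rightarrow> bool" where
  "triangulated_torus K \<longleftrightarrow>
     finite K \<and> abstract_simplicial_complex K \<and> underlying_space K homeomorphic torus"

text \<open>
  In the intersection condition disjoint simplices have the empty set as common face, so
  their images are required to be disjoint. Nothing forbids coplanar neighbouring triangles.
\<close>

definition linear_realization :: "'v set set \<Rightarrow> ('v \<Rightarrow> real ^ 3) \<Rightarrow> bool" where
  "linear_realization K f \<longleftrightarrow>
     (\<forall>s\<in>K. inj_on f s \<and> \<not> affine_dependent (f ` s)) \<and>
     (\<forall>s\<in>K. \<forall>t\<in>K. convex hull (f ` s) \<inter> convex hull (f ` t) = convex hull (f ` (s \<inter> t)))"

definition cuboid :: "nat \<Rightarrow> nat \<Rightarrow> nat \<Rightarrow> (real ^ 3) set" where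
  "cuboid a b c =
     {x. x $ 1 \<in> {0..real a} \<and> x $ 2 \<in> {0..real b} \<and> x $ 3 \<in> {0..real c}}"

definition linear_realization_in_cuboid ::
    "nat \<Rightarrow> nat \<Rightarrow> nat \<Rightarrow> 'v set set \<Rightarrow> ('v \<Rightarrow> real ^ 3) \<Rightarrow> bool" where
  "linear_realization_in_cuboid a b c K f \<longleftrightarrow>
     linear_realization K f \<and> (\<forall>v\<in>\<Union>K. f v \<in> cuboid a b c \<and> (\<forall>i. f v $ i \<in> \<int>))"

end

theory Submission
  imports Defs
begin

text \<open>
  The complex is a 3 by 3 grid with opposite sides identified and each cell cut by a diagonal.
  Summing barycentric coordinates over the rows and over the columns of the grid sends its
  underlying space to a product of two triangle boundaries, and this map is a bijection because
  on each facet the coordinates are the lengths of the pairwise intersections of two partitions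
  of the unit interval. The nine points in the cuboid are certified to give a linear realization
  by planes which, for every two facets, contain their common face and separate them strictly
  away from it.
\<close>

section \<open>Complexes given by their facets\<close>

definition complex_of_facets :: "'v set set \<Rightarrow> 'v set set" where
  "complex_of_facets T = {s. s \<noteq> {} \<and> (\<exists>t\<in>T. s \<subseteq> t)}"

lemma finite_complex_of_facets:
  assumes "finite T" "\<And>t. t \<in> T \<Longrightarrow> finite t"
  shows "finite (complex_of_facets T)"
proof -
  have "complex_of_facets T \<subseteq> (\<Union>t\<in>T. Pow t)"
    by (auto simp: complex_of_facets_def)
  then show ?thesis
    using assms by (meson finite_UN_I finite_Pow_iff finite_subset)
qed

lemma abstract_simplicial_complex_of_facets:
  assumes "\<And>t. t \<in> T \<Longrightarrow> finite t"
  shows "abstract_simplicial_complex (complex_of_facets T)"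
  unfolding abstract_simplicial_complex_def complex_of_facets_def
  using assms by (blast intro: finite_subset)

text \<open>Enlarging the support of \<open>x\<close> to a facet containing it only adds zero terms
  to the sum. Membership thus becomes a disjunction over facets, which can be split into
  cases.\<close>

lemma underlying_space_complex_of_facets:
  assumes "\<And>t. t \<in> T \<Longrightarrow> finite t"
  shows "underlying_space (complex_of_facets T) =
    {x. (\<forall>v. 0 \<le> x v) \<and> (\<exists>t\<in>T. (\<forall>v. v \<notin> t \<longrightarrow> x v = 0) \<and> sum x t = 1)}"
    (is "?L = ?R")
proof -
  have sum_eq: "(\<Sum>v | x v \<noteq> 0. x v) = sum x t"
    if "t \<in> T" "{v. x v \<noteq> 0} \<subseteq> t" for x :: "'a \<Rightarrow> real" and t
    using that assms by (intro sum.mono_neutral_left) auto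
  show ?thesis
  proof (intro equalityI subsetI)
    fix x assume "x \<in> ?L"
    then have x: "\<forall>v. 0 \<le> x v" "{v. x v \<noteq> 0} \<in> complex_of_facets T" "(\<Sum>v | x v \<noteq> 0. x v) = 1"
      by (auto simp: underlying_space_def)
    then obtain t where "t \<in> T" "{v. x v \<noteq> 0} \<subseteq> t"
      by (auto simp: complex_of_facets_def)
    then show "x \<in> ?R"
      using x sum_eq[of t x] by auto
  next
    fix x assume "x \<in> ?R"
    then obtain t where t: "\<forall>v. 0 \<le> x v" "t \<in> T" "\<forall>v. v \<notin> t \<longrightarrow> x v = 0" "sum x t = 1"
      by auto
    then have sub: "{v. x v \<noteq> 0} \<subseteq> t"
      by auto
    \<comment> \<open>The empty set is not a simplex, so the support must be nonempty; total weight
      1 ensures this.\<close>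
    moreover have "\<exists>v. x v \<noteq> 0"
      using t(4) by (metis sum.neutral zero_neq_one)
    ultimately show "x \<in> ?L"
      using t sum_eq[of t x] by (auto simp: underlying_space_def complex_of_facets_def)
  qed
qed

section \<open>Separating hyperplanes and linear realizations\<close>

text \<open>A point of both hulls lies on the hyperplane, hence is a convex combination of vertices
  on it, and these belong to both \<open>s\<close> and \<open>t\<close>. Within the affinely
  independent image of \<open>s\<close>, hulls intersect as their vertex sets do.\<close>

lemma convex_hull_Int_separated:
  fixes f :: "'v \<Rightarrow> 'a::euclidean_space"
  assumes fin: "finite s" "finite t"
    and inj: "inj_on f s"
    and ind: "\<not> affine_dependent (f ` s)"
    and common: "\<And>v. v \<in> s \<Longrightarrow> v \<in> t \<Longrightarrow> a \<bullet> f v = c"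
    and pos: "\<And>v. v \<in> s \<Longrightarrow> v \<notin> t \<Longrightarrow> a \<bullet> f v > c"
    and neg: "\<And>v. v \<in> t \<Longrightarrow> v \<notin> s \<Longrightarrow> a \<bullet> f v < c"
    and sub: "s' \<subseteq> s" "t' \<subseteq> t"
  shows "convex hull (f ` s') \<inter> convex hull (f ` t') = convex hull (f ` (s' \<inter> t'))"
proof
  \<comment> \<open>A convex combination of points on one side of a hyperplane that lands on the
    hyperplane gives weight 0 to every point off it. The sign of \<open>e\<close> selects the side,
    so that the claim serves both \<open>s'\<close> and \<open>t'\<close>.\<close>
  have face: "y \<in> convex hull (f ` (r \<inter> {v. a \<bullet> f v = c}))"
    if r: "finite r" and e: "\<And>v. v \<in> r \<Longrightarrow> 0 \<le> e * (a \<bullet> f v - c)" and "e \<noteq> 0"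
      and y: "y \<in> convex hull (f ` r)" "a \<bullet> y = c" for r y and e :: real
  proof -
    obtain u where u: "\<forall>v\<in>f ` r. 0 \<le> u v" "sum u (f ` r) = 1" "(\<Sum>v\<in>f ` r. u v *\<^sub>R v) = y"
      using y(1) r by (auto simp: convex_hull_finite)
    have "(\<Sum>v\<in>f ` r. u v * (e * (a \<bullet> v - c))) = e * (a \<bullet> y - c * sum u (f ` r))"
      unfolding u(3)[symmetric]
      by (simp add: inner_sum_right sum_distrib_left algebra_simps sum_subtractf)
    then have "(\<Sum>v\<in>f ` r. u v * (e * (a \<bullet> v - c))) = 0"
      using u y by simp
    then have "\<forall>v\<in>f ` r. u v * (e * (a \<bullet> v - c)) = 0"
      using u e r by (subst (asm) sum_nonneg_eq_0_iff) auto
    then have z: "\<forall>v\<in>f ` r - f ` (r \<inter> {v. a \<bullet> f v = c}). u v = 0"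
      using \<open>e \<noteq> 0\<close> by force
    have sub: "f ` (r \<inter> {v. a \<bullet> f v = c}) \<subseteq> f ` r"
      by auto
    have "sum u (f ` (r \<inter> {v. a \<bullet> f v = c})) = 1"
      unfolding u(2)[symmetric] by (rule sum.mono_neutral_left) (use z r sub in auto)
    moreover have "(\<Sum>v\<in>f ` (r \<inter> {v. a \<bullet> f v = c}). u v *\<^sub>R v) = y"
      unfolding u(3)[symmetric] by (rule sum.mono_neutral_left) (use z r sub in auto)
    moreover have "finite (f ` (r \<inter> {v. a \<bullet> f v = c}))"
      using r by simp
    ultimately show ?thesis
      using u(1) sub by (auto simp: convex_hull_finite)
  qed
  show "convex hull (f ` s') \<inter> convex hull (f ` t') \<subseteq> convex hull (f ` (s' \<inter> t'))"
  proof
    fix y assume y: "y \<in> convex hull (f ` s') \<inter> convex hull (f ` t')"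
    have "f ` s' \<subseteq> {y. a \<bullet> y \<ge> c}" "f ` t' \<subseteq> {y. a \<bullet> y \<le> c}"
      using sub common pos neg by (auto simp: image_subset_iff) (metis less_eq_real_def subsetD)+
    then have "convex hull (f ` s') \<subseteq> {y. a \<bullet> y \<ge> c}" "convex hull (f ` t') \<subseteq> {y. a \<bullet> y \<le> c}"
      by (simp_all add: hull_minimal convex_halfspace_ge convex_halfspace_le)
    then have yc: "a \<bullet> y = c"
      using y by force
    have "y \<in> convex hull (f ` (s' \<inter> {v. a \<bullet> f v = c}))"
    proof (rule face[of _ 1])
      show "finite s'"
        using fin sub by (auto intro: finite_subset)
      show "0 \<le> 1 * (a \<bullet> f v - c)" if "v \<in> s'" for v
        using sub common[of v] pos[of v] that by fastforce
    qed (use y yc in auto)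
    moreover have "s' \<inter> {v. a \<bullet> f v = c} \<subseteq> s' \<inter> t"
      using sub pos by force
    ultimately have 1: "y \<in> convex hull (f ` (s' \<inter> t))"
      by (meson hull_mono image_mono subsetD)
    have "y \<in> convex hull (f ` (t' \<inter> {v. a \<bullet> f v = c}))"
    proof (rule face[of _ "-1"])
      show "finite t'"
        using fin sub by (auto intro: finite_subset)
      show "0 \<le> (-1) * (a \<bullet> f v - c)" if "v \<in> t'" for v
        using sub common[of v] neg[of v] that by fastforce
    qed (use y yc in auto)
    moreover have "t' \<inter> {v. a \<bullet> f v = c} \<subseteq> t' \<inter> s"
      using sub neg by force
    ultimately have 2: "y \<in> convex hull (f ` (t' \<inter> s))"
      by (meson hull_mono image_mono subsetD)
    \<comment> \<open>Both vertex sets have been cut down to subsets of \<open>s\<close>, so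
      independence of its image applies to their union.\<close>
    have "f ` (s' \<inter> t) \<union> f ` (t' \<inter> s) \<subseteq> f ` s"
      using sub by auto
    then have "\<not> affine_dependent (f ` (s' \<inter> t) \<union> f ` (t' \<inter> s))"
      using ind affine_dependent_subset by blast
    then have "y \<in> convex hull (f ` (s' \<inter> t) \<inter> f ` (t' \<inter> s))"
      using 1 2 by (simp add: convex_hull_Int)
    also have "f ` (s' \<inter> t) \<inter> f ` (t' \<inter> s) = f ` (s' \<inter> t')"
    proof -
      have "(s' \<inter> t) \<inter> (t' \<inter> s) = s' \<inter> t'"
        using sub by blast
      then show ?thesis
        using inj_on_image_Int[OF inj, of "s' \<inter> t" "t' \<inter> s"] sub by auto
    qed
    finally show "y \<in> convex hull (f ` (s' \<inter> t'))" .
  qed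
qed (simp add: hull_mono image_mono)

text \<open>
  If every codimension-one face of a facet is shared with another facet, then the hyperplanes
  separating the facets also witness that each single facet is nondegenerate.
\<close>

lemma linear_realization_separated:
  fixes f :: "'v \<Rightarrow> real ^ 3"
  assumes fin: "\<And>t. t \<in> T \<Longrightarrow> finite t"
    and sep: "\<And>s t. s \<in> T \<Longrightarrow> t \<in> T \<Longrightarrow> s \<noteq> t \<Longrightarrow>
      \<exists>a c. (\<forall>v\<in>s \<inter> t. a \<bullet> f v = c) \<and> (\<forall>v\<in>s - t. a \<bullet> f v > c) \<and> (\<forall>v\<in>t - s. a \<bullet> f v < c)"
    and shared: "\<And>t v. t \<in> T \<Longrightarrow> v \<in> t \<Longrightarrow> \<exists>t'\<in>T. t \<inter> t' = t - {v}"
  shows "linear_realization (complex_of_facets T) f"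
proof -
  \<comment> \<open>The hyperplane separating \<open>t\<close> from its neighbor across the face
    opposite \<open>v\<close> contains that face and misses \<open>v\<close>. Injectivity and affine
    independence both follow from this.\<close>
  have opposite: "\<exists>a c. a \<bullet> f v > c \<and> (\<forall>w\<in>t - {v}. a \<bullet> f w = c)" if "t \<in> T" "v \<in> t" for t v
  proof -
    obtain t' where t': "t' \<in> T" "t \<inter> t' = t - {v}"
      using shared \<open>t \<in> T\<close> \<open>v \<in> t\<close> by blast
    then have "v \<notin> t'" "t \<noteq> t'"
      using \<open>v \<in> t\<close> by blast+
    obtain a c where ac: "\<forall>v\<in>t \<inter> t'. a \<bullet> f v = c" "\<forall>v\<in>t - t'. a \<bullet> f v > c"
      using sep[OF \<open>t \<in> T\<close> t'(1) \<open>t \<noteq> t'\<close>] by blast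
    then show ?thesis
      using t'(2) \<open>v \<in> t\<close> \<open>v \<notin> t'\<close> by (metis DiffI)
  qed
  have inj: "inj_on f t" if "t \<in> T" for t
  proof (rule inj_onI, rule ccontr)
    fix v w assume "v \<in> t" "w \<in> t" "f v = f w" "v \<noteq> w"
    with opposite[OF \<open>t \<in> T\<close> \<open>v \<in> t\<close>] show False
      by (metis DiffI less_irrefl singletonD)
  qed
  have ind: "\<not> affine_dependent (f ` t)" if t: "t \<in> T" for t
  proof
    assume "affine_dependent (f ` t)"
    then obtain v where v: "v \<in> t" "f v \<in> affine hull (f ` t - {f v})"
      by (auto simp: affine_dependent_def)
    obtain a c where ac: "a \<bullet> f v > c" "\<forall>w\<in>t - {v}. a \<bullet> f w = c"
      using opposite[OF t v(1)] by blast
    have "affine hull (f ` t - {f v}) \<subseteq> {y. a \<bullet> y = c}"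
      using ac by (intro hull_minimal affine_hyperplane) auto
    then show False
      using v ac by auto
  qed
  have hull: "convex hull (f ` s') \<inter> convex hull (f ` t') = convex hull (f ` (s' \<inter> t'))"
    if "s \<in> T" "t \<in> T" "s' \<subseteq> s" "t' \<subseteq> t" for s t s' t'
  proof (cases "s = t")
    case True
    have "\<not> affine_dependent (f ` s' \<union> f ` t')"
      using ind[OF \<open>s \<in> T\<close>] affine_dependent_subset[of "f ` s' \<union> f ` t'" "f ` s"] that True by blast
    then show ?thesis
      using inj_on_image_Int[OF inj[OF \<open>s \<in> T\<close>], of s' t'] that True
      by (simp add: convex_hull_Int)
  next
    case False
    then obtain a c where ac: "\<forall>v\<in>s \<inter> t. a \<bullet> f v = c" "\<forall>v\<in>s - t. a \<bullet> f v > c" "\<forall>v\<in>t - s. a \<bullet> f v < c"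
      using sep[OF \<open>s \<in> T\<close> \<open>t \<in> T\<close>] by blast
    show ?thesis
      by (rule convex_hull_Int_separated[of s t f a c]) (use ac that fin inj ind in auto)
  qed
  have facet: "\<exists>t\<in>T. s \<subseteq> t" if "s \<in> complex_of_facets T" for s
    using that by (auto simp: complex_of_facets_def)
  show ?thesis
    unfolding linear_realization_def
  proof (intro conjI ballI)
    fix s assume "s \<in> complex_of_facets T"
    then obtain t where t: "t \<in> T" "s \<subseteq> t"
      using facet by blast
    show "inj_on f s"
      using inj t inj_on_subset by blast
    show "\<not> affine_dependent (f ` s)"
      using ind[OF t(1)] affine_dependent_subset[OF _ image_mono[OF t(2)]] by blast
  next
    fix s' t' assume "s' \<in> complex_of_facets T" "t' \<in> complex_of_facets T"
    then obtain s t where "s \<in> T" "s' \<subseteq> s" "t \<in> T" "t' \<subseteq> t"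
      using facet by meson
    then show "convex hull (f ` s') \<inter> convex hull (f ` t') = convex hull (f ` (s' \<inter> t'))"
      by (intro hull)
  qed
qed

section \<open>The boundary of a triangle\<close>

text \<open>\<open>Re z\<close>, \<open>Im z\<close> and \<open>1 - Re z - Im z\<close> are
  barycentric coordinates; the last condition says that one of them vanishes.\<close>

definition triangle_boundary :: "complex set" where
  "triangle_boundary = {z. 0 \<le> Re z \<and> 0 \<le> Im z \<and> Re z + Im z \<le> 1 \<and>
     (Re z = 0 \<or> Im z = 0 \<or> Re z + Im z = 1)}"

text \<open>The full triangle and the disc are compact convex sets with nonempty interior in the
  plane, so their relative frontiers are homeomorphic.\<close>

lemma triangle_boundary_homeomorphic_sphere:
  "triangle_boundary homeomorphic sphere (0::complex) 1"
proof -
  \<comment> \<open>The inner products are \<open>Re z\<close>, \<open>Im z\<close> and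
    \<open>Re z + Im z\<close>; in this form the halfspace lemmas apply.\<close>
  define S where "S = {z. 1 \<bullet> z \<ge> 0} \<inter> {z. \<i> \<bullet> z \<ge> 0} \<inter> {z. (1 + \<i>) \<bullet> z \<le> (1::real)}"
  have nz: "1 + \<i> \<noteq> 0"
    by (simp add: complex_eq_iff)
  have int: "interior S = {z. 1 \<bullet> z > 0} \<inter> {z. \<i> \<bullet> z > 0} \<inter> {z. (1 + \<i>) \<bullet> z < (1::real)}"
    using nz unfolding S_def interior_Int by (simp only: interior_halfspace_ge interior_halfspace_le
      one_neq_zero complex_i_not_zero not_False_eq_True)
  have "closed S"
    unfolding S_def by (intro closed_Int closed_halfspace_ge closed_halfspace_le)
  moreover have "convex S"
    unfolding S_def by (intro convex_Int convex_halfspace_ge convex_halfspace_le)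
  moreover have "bounded S"
  proof (rule boundedI[of _ 2])
    fix z assume "z \<in> S"
    then show "norm z \<le> 2"
      using cmod_le[of z] by (auto simp: S_def inner_complex_def)
  qed
  moreover have "Complex (1/4) (1/4) \<in> interior S"
    by (simp add: int inner_complex_def)
  then have "interior S \<noteq> {}"
    by blast
  ultimately have "rel_frontier S homeomorphic rel_frontier (cball (0::complex) 1)"
    by (intro homeomorphic_rel_frontiers_convex_bounded_sets)
      (auto simp: aff_dim_nonempty_interior)
  moreover have "rel_frontier S = triangle_boundary"
    using \<open>interior S \<noteq> {}\<close> \<open>closed S\<close> unfolding rel_frontier_nonempty_interior[OF \<open>interior S \<noteq> {}\<close>]
      frontier_def int by (auto simp: S_def triangle_boundary_def inner_complex_def)
  ultimately show ?thesis
    by simp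
qed

lemma homeomorphic_Times:
  assumes "S homeomorphic S'" "T homeomorphic T'"
  shows "(S \<times> T) homeomorphic (S' \<times> T')"
proof -
  obtain f f' g g' where fg: "homeomorphism S S' f f'" "homeomorphism T T' g g'"
    using assms by (auto simp: homeomorphic_def)
  have cont: "continuous_on (A \<times> B) (\<lambda>p. (h (fst p), k (snd p)))"
    if "continuous_on A h" "continuous_on B k" for A B
      and h :: "'e::topological_space \<Rightarrow> 'f::topological_space"
      and k :: "'g::topological_space \<Rightarrow> 'h::topological_space"
    by (intro continuous_on_Pair continuous_on_compose2[OF that(1)] continuous_on_compose2[OF that(2)]
        continuous_on_fst continuous_on_snd continuous_on_id) auto
  have "homeomorphism (S \<times> T) (S' \<times> T') (\<lambda>p. (f (fst p), g (snd p))) (\<lambda>p. (f' (fst p), g' (snd p)))"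
  proof (rule homeomorphismI)
    show "(\<lambda>p. (f (fst p), g (snd p))) ` (S \<times> T) \<subseteq> S' \<times> T'"
      and "(\<lambda>p. (f' (fst p), g' (snd p))) ` (S' \<times> T') \<subseteq> S \<times> T"
      using fg[THEN homeomorphism_image1] fg[THEN homeomorphism_image2] by auto
  qed (auto intro: cont fg[THEN homeomorphism_cont1] fg[THEN homeomorphism_cont2]
      simp: homeomorphism_apply1[OF fg(1)] homeomorphism_apply1[OF fg(2)]
        homeomorphism_apply2[OF fg(1)] homeomorphism_apply2[OF fg(2)])
  then show ?thesis
    by (auto simp: homeomorphic_def)
qed

section \<open>The nine-vertex torus\<close>

text \<open>
  The vertex \<open>3 * i + j\<close> is in row \<open>i\<close> and column \<open>j\<close>. For columns \<open>j < k\<close>, the cell between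
  rows \<open>i\<close> and \<open>i + 1\<close> (mod 3) is cut by the diagonal from \<open>(i + 1, j)\<close> to \<open>(i, k)\<close>.
\<close>

definition torus_facets :: "nat list list" where
  "torus_facets =
    [[0, 3, 1], [3, 1, 4], [0, 3, 2], [3, 2, 5], [1, 4, 2], [4, 2, 5],
     [3, 6, 4], [6, 4, 7], [3, 6, 5], [6, 5, 8], [4, 7, 5], [7, 5, 8],
     [6, 0, 7], [0, 7, 1], [6, 0, 8], [0, 8, 2], [7, 1, 8], [1, 8, 2]]"

abbreviation torus_complex :: "nat set set" where
  "torus_complex \<equiv> complex_of_facets (set ` set torus_facets)"

text \<open>
  The point \<open>z\<close> of the triangle boundary has barycentric coordinates \<open>Re z, Im z, 1 - Re z - Im z\<close>,
  the lengths of the three row intervals. Since one of them vanishes, placing the interval of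
  row \<open>i\<close> right after one as long as that of row \<open>i + 1\<close> (mod 3) partitions the unit interval, with
  the same cyclic rule for every \<open>i\<close>. The column intervals are placed in their linear order.
\<close>

definition row_start :: "nat \<Rightarrow> complex \<Rightarrow> real" where
  "row_start i z = (if i = 0 then Im z else if i = 1 then 1 - Re z - Im z else Re z)"

definition row_end :: "nat \<Rightarrow> complex \<Rightarrow> real" where
  "row_end i z = row_start i z + (if i = 0 then Re z else if i = 1 then Im z else 1 - Re z - Im z)"

definition col_start :: "nat \<Rightarrow> complex \<Rightarrow> real" where
  "col_start j w = (if j = 0 then 0 else if j = 1 then Re w else Re w + Im w)"

definition col_end :: "nat \<Rightarrow> complex \<Rightarrow> real" where
  "col_end j w = (if j = 0 then Re w else if j = 1 then Re w + Im w else 1)"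

text \<open>The cutoff at 0 covers intervals that do not meet. Indices from 9 on are not vertices of
  the complex.\<close>

definition weights :: "complex \<times> complex \<Rightarrow> nat \<Rightarrow> real" where
  "weights p v = (if v < 9
     then max 0 (min (row_end (v div 3) (fst p)) (col_end (v mod 3) (snd p)) -
                 max (row_start (v div 3) (fst p)) (col_start (v mod 3) (snd p)))
     else 0)"

text \<open>Two row sums and two column sums suffice, since the total weight is 1.\<close>

definition marginals :: "(nat \<Rightarrow> real) \<Rightarrow> complex \<times> complex" where
  "marginals x = (Complex (x 0 + x 1 + x 2) (x 3 + x 4 + x 5),
                  Complex (x 0 + x 3 + x 6) (x 1 + x 4 + x 7))"

section \<open>The homeomorphism with a product of triangle boundaries\<close>

lemma continuous_on_weights: "continuous_on S weights"
proof (rule continuous_on_coordinatewise_then_product)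
  fix v
  have ends: "continuous_on A (row_start i)" "continuous_on A (row_end i)"
    "continuous_on A (col_start i)" "continuous_on A (col_end i)" for A i
    unfolding row_end_def[abs_def] row_start_def[abs_def] col_start_def[abs_def] col_end_def[abs_def]
    by (cases "i = 0"; cases "i = 1"; simp add: continuous_on_add continuous_on_diff
        continuous_on_Re continuous_on_Im)+
  show "continuous_on S (\<lambda>p. weights p v)"
    unfolding weights_def
    by (cases "v < 9") (auto intro!: continuous_on_max continuous_on_min continuous_on_diff
        continuous_on_const continuous_on_fst continuous_on_snd continuous_on_id
        ends[THEN continuous_on_compose2[OF _ _ subset_UNIV]])
qed

lemma continuous_on_marginals: "continuous_on S marginals"
  unfolding marginals_def Complex_eq
  by (intro continuous_on_Pair continuous_on_add continuous_on_mult continuous_on_of_real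
      continuous_on_const continuous_on_subset[OF continuous_on_product_coordinates subset_UNIV])

lemma underlying_space_torus_complex:
  "underlying_space torus_complex = {x. (\<forall>v. 0 \<le> x v) \<and>
     (\<exists>t\<in>set torus_facets. (\<forall>v. v \<notin> set t \<longrightarrow> x v = 0) \<and> sum x (set t) = 1)}"
  by (subst underlying_space_complex_of_facets) auto

lemma nat_below_9: "{..<9::nat} \<subseteq> {0,1,2,3,4,5,6,7,8}"
  by (auto simp: lessThan_nat_numeral lessThan_Suc)

text \<open>A facet is a staircase in a cell: it starts at \<open>(i + 1, j)\<close>, ends at
  \<open>(i, k)\<close>, and passes through one of the other two corners. Laid end to end in this
  order, its three coordinates are the pieces of the common refinement of the two partitions, so the
  overlaps recover them.\<close>

lemma weights_marginals:
  assumes "x \<in> underlying_space torus_complex"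
  shows "marginals x \<in> triangle_boundary \<times> triangle_boundary" "weights (marginals x) = x"
proof -
  obtain t where t: "t \<in> set torus_facets" "\<forall>v. v \<notin> set t \<longrightarrow> x v = 0" "sum x (set t) = 1"
    and nonneg: "\<forall>v. 0 \<le> x v"
    using assms by (auto simp: underlying_space_torus_complex)
  have nonneg': "0 \<le> x 0" "0 \<le> x 1" "0 \<le> x 2" "0 \<le> x 3" "0 \<le> x 4" "0 \<le> x 5" "0 \<le> x 6" "0 \<le> x 7" "0 \<le> x 8"
    using nonneg by auto
  note zero = t(2)[rule_format, of 0] t(2)[rule_format, of 1] t(2)[rule_format, of 2]
     t(2)[rule_format, of 3] t(2)[rule_format, of 4] t(2)[rule_format, of 5]
     t(2)[rule_format, of 6] t(2)[rule_format, of 7] t(2)[rule_format, of 8]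
  note cases = t(1)[unfolded torus_facets_def list.set insert_iff empty_iff]
  show "marginals x \<in> triangle_boundary \<times> triangle_boundary"
    using cases by (elim disjE FalseE; use nonneg' zero t(3) in \<open>simp add: marginals_def triangle_boundary_def\<close>)
  show "weights (marginals x) = x"
  proof
    fix v :: nat
    consider "v \<ge> 9" | "v \<in> {0,1,2,3,4,5,6,7,8}"
      using nat_below_9 by (meson not_le lessThan_iff subset_eq)
    then show "weights (marginals x) v = x v"
    proof cases
      case 1
      moreover have "v \<notin> set t"
        using cases 1 by (elim disjE FalseE; simp)
      ultimately show ?thesis
        using t(2) by (simp add: weights_def)
    next
      case 2
      have "\<forall>v\<in>{0,1,2,3,4,5,6,7,8}. weights (marginals x) v = x v"
        using cases
        by (elim disjE FalseE; use nonneg' zero t(3) in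
          \<open>simp add: weights_def marginals_def row_start_def row_end_def col_start_def col_end_def\<close>)
      with 2 show ?thesis
        by blast
    qed
  qed
qed

text \<open>A side of each triangle selects two rows and two columns, hence a cell. Which of its two
  facets carries the weights depends on whether the row or the column breakpoint comes
  first.\<close>

lemma marginals_weights:
  assumes "p \<in> triangle_boundary \<times> triangle_boundary"
  shows "weights p \<in> underlying_space torus_complex" "marginals (weights p) = p"
proof -
  obtain z w where p: "p = (z, w)"
    by (cases p)
  have z: "0 \<le> Re z" "0 \<le> Im z" "Re z + Im z \<le> 1" "Re z = 0 \<or> Im z = 0 \<or> Re z + Im z = 1"
    and w: "0 \<le> Re w" "0 \<le> Im w" "Re w + Im w \<le> 1" "Re w = 0 \<or> Im w = 0 \<or> Re w + Im w = 1"
    using assms by (simp_all add: p triangle_boundary_def)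
  \<comment> \<open>Both conclusions are packed into one predicate, so that one case distinction
    proves them. Listing the nine vertices lets the simplifier evaluate each weight.\<close>
  define fits where "fits t \<longleftrightarrow> t \<in> set torus_facets \<and>
    (\<forall>v\<in>{0,1,2,3,4,5,6,7,8}. v \<notin> set t \<longrightarrow> weights (z, w) v = 0) \<and>
    sum (weights (z, w)) (set t) = 1 \<and> marginals (weights (z, w)) = (z, w)" for t
  \<comment> \<open>The row breakpoint is \<open>Im z\<close>, \<open>1 - Im z\<close> or
    \<open>Re z\<close>, and the column breakpoint \<open>Re w\<close> or \<open>Im w\<close>,
    according to which coordinates vanish. In a tie both facets fit.\<close>
  have
    "Re z + Im z = 1 \<Longrightarrow> Re w + Im w = 1 \<Longrightarrow> Im z \<le> Re w \<Longrightarrow> fits [0, 3, 1]"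
    "Re z + Im z = 1 \<Longrightarrow> Re w + Im w = 1 \<Longrightarrow> Re w \<le> Im z \<Longrightarrow> fits [3, 1, 4]"
    "Re z + Im z = 1 \<Longrightarrow> Im w = 0 \<Longrightarrow> Im z \<le> Re w \<Longrightarrow> fits [0, 3, 2]"
    "Re z + Im z = 1 \<Longrightarrow> Im w = 0 \<Longrightarrow> Re w \<le> Im z \<Longrightarrow> fits [3, 2, 5]"
    "Re z + Im z = 1 \<Longrightarrow> Re w = 0 \<Longrightarrow> Im z \<le> Im w \<Longrightarrow> fits [1, 4, 2]"
    "Re z + Im z = 1 \<Longrightarrow> Re w = 0 \<Longrightarrow> Im w \<le> Im z \<Longrightarrow> fits [4, 2, 5]"
    "Re z = 0 \<Longrightarrow> Re w + Im w = 1 \<Longrightarrow> 1 - Im z \<le> Re w \<Longrightarrow> fits [3, 6, 4]"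
    "Re z = 0 \<Longrightarrow> Re w + Im w = 1 \<Longrightarrow> Re w \<le> 1 - Im z \<Longrightarrow> fits [6, 4, 7]"
    "Re z = 0 \<Longrightarrow> Im w = 0 \<Longrightarrow> 1 - Im z \<le> Re w \<Longrightarrow> fits [3, 6, 5]"
    "Re z = 0 \<Longrightarrow> Im w = 0 \<Longrightarrow> Re w \<le> 1 - Im z \<Longrightarrow> fits [6, 5, 8]"
    "Re z = 0 \<Longrightarrow> Re w = 0 \<Longrightarrow> 1 - Im z \<le> Im w \<Longrightarrow> fits [4, 7, 5]"
    "Re z = 0 \<Longrightarrow> Re w = 0 \<Longrightarrow> Im w \<le> 1 - Im z \<Longrightarrow> fits [7, 5, 8]"
    "Im z = 0 \<Longrightarrow> Re w + Im w = 1 \<Longrightarrow> Re z \<le> Re w \<Longrightarrow> fits [6, 0, 7]"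
    "Im z = 0 \<Longrightarrow> Re w + Im w = 1 \<Longrightarrow> Re w \<le> Re z \<Longrightarrow> fits [0, 7, 1]"
    "Im z = 0 \<Longrightarrow> Im w = 0 \<Longrightarrow> Re z \<le> Re w \<Longrightarrow> fits [6, 0, 8]"
    "Im z = 0 \<Longrightarrow> Im w = 0 \<Longrightarrow> Re w \<le> Re z \<Longrightarrow> fits [0, 8, 2]"
    "Im z = 0 \<Longrightarrow> Re w = 0 \<Longrightarrow> Re z \<le> Im w \<Longrightarrow> fits [7, 1, 8]"
    "Im z = 0 \<Longrightarrow> Re w = 0 \<Longrightarrow> Im w \<le> Re z \<Longrightarrow> fits [1, 8, 2]"
    using z(1-3) w(1-3) unfolding fits_def marginals_def torus_facets_def
    by (simp_all add: weights_def row_start_def row_end_def col_start_def col_end_def complex_eq_iff)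
  then have "\<exists>t. fits t"
    using z(4) w(4) by (metis linear)
  then obtain t where t: "fits t"
    by blast
  show "marginals (weights p) = p"
    using t by (simp add: fits_def p)
  have "weights (z, w) v = 0" if "v \<notin> set t" for v
  proof (cases "v < 9")
    case True
    then have "v \<in> {0,1,2,3,4,5,6,7,8}"
      using nat_below_9 by blast
    then show ?thesis
      using t that unfolding fits_def by blast
  qed (simp add: weights_def)
  moreover have "0 \<le> weights (z, w) v" for v
    by (simp add: weights_def)
  ultimately show "weights p \<in> underlying_space torus_complex"
    using t by (auto simp: underlying_space_torus_complex p fits_def)
qed

lemma triangulated_torus_torus_complex: "triangulated_torus torus_complex"
proof -
  have "homeomorphism (underlying_space torus_complex) (triangle_boundary \<times> triangle_boundary)
    marginals weights"
    using weights_marginals marginals_weights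
    by (intro homeomorphismI continuous_on_marginals continuous_on_weights) blast+
  then have "underlying_space torus_complex homeomorphic triangle_boundary \<times> triangle_boundary"
    by (auto simp: homeomorphic_def)
  also have "triangle_boundary \<times> triangle_boundary homeomorphic torus"
    unfolding torus_def
    by (intro homeomorphic_Times triangle_boundary_homeomorphic_sphere)
  finally show ?thesis
    unfolding triangulated_torus_def
    by (auto intro!: finite_complex_of_facets abstract_simplicial_complex_of_facets)
qed

section \<open>Integer points and certified separating planes\<close>

definition torus_points :: "(int \<times> int \<times> int) list" where
  "torus_points =
    [(0, 1, 2), (1, 0, 2), (1, 1, 1), (0, 2, 2), (1, 2, 1),
     (1, 0, 0), (0, 1, 1), (0, 0, 0), (1, 0, 1)]"

text \<open>The entry \<open>(a, b, c, d)\<close> encodes the plane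
  \<open>2 * (a * x + b * y + c * z) = d\<close>. There are fewer planes than pairs of facets, as
  one plane may serve several pairs.\<close>

definition separators :: "(int \<times> int \<times> int \<times> int) list" where
  "separators =
    [(1, 2, -1, 1), (1, 1, 1, 5), (1, -1, 2, 3), (1, 1, -2, 0), (3, 2, -1, 2),
     (4, -1, -2, 0), (2, 1, 3, 14), (2, 1, 0, 3), (2, -3, 2, 0), (2, 2, 1, 8),
     (3, -1, 3, 8), (1, 1, -1, 0), (1, 2, -1, 2), (2, 1, 2, 8), (0, 1, 1, 4),
     (1, 0, -2, -2), (1, 1, -2, -1), (2, -1, 1, 2), (2, 1, 0, 4), (2, 4, -1, 2),
     (2, -3, 4, 2), (1, -3, 5, 2), (3, -3, 4, 4), (4, 5, -2, 2), (4, -1, 3, 9),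
     (4, 1, 2, 14), (5, 2, 4, 24), (0, 1, 0, 1), (1, -1, 0, 0), (0, 2, -1, 0),
     (1, -1, 2, 2), (3, 1, 0, 6), (2, 1, 1, 7), (2, -1, 2, 6), (3, 3, -1, 6),
     (1, 1, -1, 2), (1, 2, 0, 2), (2, 1, 0, 2), (1, -2, 2, 0), (3, 0, -2, 0),
     (2, 2, -1, 1), (1, -1, 2, 4), (2, 0, 1, 6), (1, 3, -1, 2), (2, 2, -1, 3),
     (1, 0, 2, 8), (2, 1, 1, 6), (2, 3, -2, 2), (2, -2, 3, 3), (3, 1, 1, 8),
     (2, -2, 3, 6), (2, 1, 2, 11), (0, 2, 3, 12)]"

text \<open>The factor 2 allows planes with a half-integral offset.\<close>

fun height :: "int \<times> int \<times> int \<times> int \<Rightarrow> int \<times> int \<times> int \<Rightarrow> int" where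
  "height (a, b, c, d) (x, y, z) = 2 * (a * x + b * y + c * z) - d"

text \<open>Phrased with integers and lists so that it can be decided by evaluation.\<close>

definition separates :: "int \<times> int \<times> int \<times> int \<Rightarrow> nat list \<Rightarrow> nat list \<Rightarrow> bool" where
  "separates h s t \<longleftrightarrow>
    (\<forall>v\<in>set s. if v \<in> set t then height h (torus_points ! v) = 0 else 0 < height h (torus_points ! v)) \<and>
    (\<forall>v\<in>set t. v \<in> set s \<or> height h (torus_points ! v) < 0)"

lemma torus_facets_separated:
  "\<forall>s\<in>set torus_facets. \<forall>t\<in>set torus_facets.
    s = t \<or> (\<exists>h\<in>set separators. separates h s t \<or> separates h t s)"
  by code_simp

text \<open>The surface has no boundary. This is what lets the separating planes also prove each
  triangle nondegenerate.\<close>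

lemma torus_facets_share_edges:
  "\<forall>t\<in>set torus_facets. \<forall>v\<in>set t. \<exists>t'\<in>set torus_facets. set t \<inter> set t' = set t - {v}"
  by code_simp

definition realization :: "nat \<Rightarrow> real ^ 3" where
  "realization v = (case torus_points ! v of (x, y, z) \<Rightarrow> vector [of_int x, of_int y, of_int z])"

text \<open>Passes from the evaluated integer heights to real hyperplanes.\<close>

lemma height_realization:
  obtains a :: "real ^ 3" and c where
    "\<And>v. of_int (height h (torus_points ! v)) = a \<bullet> realization v - c"
proof -
  obtain p q r d where h: "h = (p, q, r, d)"
    by (cases h)
  have "of_int (height h (torus_points ! v)) =
      vector [2 * of_int p, 2 * of_int q, 2 * of_int r] \<bullet> realization v - of_int d" for v
    by (cases "torus_points ! v")
      (simp add: h realization_def inner_vec_def sum_3 vector_3 algebra_simps)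
  then show ?thesis
    by (rule that)
qed

lemma separates_realization:
  assumes "separates h s t"
  shows "\<exists>a c. (\<forall>v\<in>set s \<inter> set t. a \<bullet> realization v = c) \<and>
    (\<forall>v\<in>set s - set t. a \<bullet> realization v > c) \<and> (\<forall>v\<in>set t - set s. a \<bullet> realization v < c)"
    and "\<exists>a c. (\<forall>v\<in>set t \<inter> set s. a \<bullet> realization v = c) \<and>
    (\<forall>v\<in>set t - set s. a \<bullet> realization v > c) \<and> (\<forall>v\<in>set s - set t. a \<bullet> realization v < c)"
proof -
  obtain a :: "real ^ 3" and c where ac: "\<And>v. of_int (height h (torus_points ! v)) = a \<bullet> realization v - c"
    using height_realization[of h] by blast
  have "height h (torus_points ! v) = 0 \<longleftrightarrow> a \<bullet> realization v = c"
    "0 < height h (torus_points ! v) \<longleftrightarrow> c < a \<bullet> realization v"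
    "height h (torus_points ! v) < 0 \<longleftrightarrow> a \<bullet> realization v < c" for v
    using ac[of v] by linarith+
  then have *: "\<forall>v\<in>set s \<inter> set t. a \<bullet> realization v = c" "\<forall>v\<in>set s - set t. a \<bullet> realization v > c"
    "\<forall>v\<in>set t - set s. a \<bullet> realization v < c"
    using assms unfolding separates_def by (metis IntD1 IntD2 DiffD1 DiffD2)+
  show "\<exists>a c. (\<forall>v\<in>set s \<inter> set t. a \<bullet> realization v = c) \<and>
    (\<forall>v\<in>set s - set t. a \<bullet> realization v > c) \<and> (\<forall>v\<in>set t - set s. a \<bullet> realization v < c)"
    using * by blast
  \<comment> \<open>Negating normal and offset swaps the two sides, so one listed plane serves both
    orders of a pair.\<close>
  have "\<forall>v\<in>set t \<inter> set s. - a \<bullet> realization v = - c" "\<forall>v\<in>set t - set s. - a \<bullet> realization v > - c"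
    "\<forall>v\<in>set s - set t. - a \<bullet> realization v < - c"
    using * by simp_all
  then show "\<exists>a c. (\<forall>v\<in>set t \<inter> set s. a \<bullet> realization v = c) \<and>
    (\<forall>v\<in>set t - set s. a \<bullet> realization v > c) \<and> (\<forall>v\<in>set s - set t. a \<bullet> realization v < c)"
    by blast
qed

lemma linear_realization_torus_complex: "linear_realization torus_complex realization"
proof -
  let ?T = "set ` set torus_facets"
  have fin: "finite t" if "t \<in> ?T" for t
    using that by (metis imageE finite_set)
  have shared: "\<exists>t'\<in>?T. t \<inter> t' = t - {v}" if t: "t \<in> ?T" "v \<in> t" for t v
  proof -
    obtain xs where xs: "xs \<in> set torus_facets" "t = set xs"
      using t(1) by (rule imageE)
    then obtain ys where "ys \<in> set torus_facets" "set xs \<inter> set ys = set xs - {v}"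
      using torus_facets_share_edges t(2) by meson
    then show ?thesis
      unfolding xs(2) by (meson imageI)
  qed
  have sep: "\<exists>a c. (\<forall>v\<in>s \<inter> t. a \<bullet> realization v = c) \<and>
    (\<forall>v\<in>s - t. a \<bullet> realization v > c) \<and> (\<forall>v\<in>t - s. a \<bullet> realization v < c)"
    if s: "s \<in> ?T" and t: "t \<in> ?T" and "s \<noteq> t" for s t
  proof -
    obtain xs where xs: "xs \<in> set torus_facets" "s = set xs"
      using s by (rule imageE)
    obtain ys where ys: "ys \<in> set torus_facets" "t = set ys"
      using t by (rule imageE)
    have "xs \<noteq> ys"
      using \<open>s \<noteq> t\<close> xs(2) ys(2) by meson
    then obtain h where "separates h xs ys \<or> separates h ys xs"
      using torus_facets_separated xs(1) ys(1) by meson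
    then show ?thesis
      unfolding xs(2) ys(2) using separates_realization by (elim disjE)
  qed
  show ?thesis
    by (rule linear_realization_separated[OF fin sep shared])
qed

lemma realization_in_cuboid: "linear_realization_in_cuboid 1 2 2 torus_complex realization"
proof -
  \<comment> \<open>From 9 on, \<open>torus_points ! v\<close> is out of range, so the check must be
    confined to actual vertices.\<close>
  have vertices: "\<Union> torus_complex \<subseteq> {0, 1, 2, 3, 4, 5, 6, 7, 8}"
    by (auto simp: complex_of_facets_def torus_facets_def)
  have "\<forall>v\<in>{0, 1, 2, 3, 4, 5, 6, 7, 8}. realization v \<in> cuboid 1 2 2 \<and> (\<forall>i. realization v $ i \<in> \<int>)"
    by (simp add: realization_def torus_points_def cuboid_def forall_3 vector_3)
  then show ?thesis
    unfolding linear_realization_in_cuboid_def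
    using linear_realization_torus_complex vertices by blast
qed

theorem mainTheorem4:
  "\<exists>(K :: nat set set) (f :: nat \<Rightarrow> real ^ 3).
     triangulated_torus K \<and> linear_realization_in_cuboid 1 2 2 K f"
proof (intro exI conjI)
  show "triangulated_torus torus_complex"
    by (rule triangulated_torus_torus_complex)
  show "linear_realization_in_cuboid 1 2 2 torus_complex realization"
    by (rule realization_in_cuboid)
qed

end
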